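(* Let $M$ be a square $n\times n$ matrix with entries in a commutative ring, and let $k$ be any integer with $1\le k\le n$. Then $$\det(M)\cdot\det\bigl(M[\{k+1,\dots,n\},\{k+1,\dots,n\}]\bigr)^{k-1}=\sum_{\sigma\in S_k}(-1)^{\iota(\sigma)}\prod_{i=1}^k\det\bigl(M[\{i,k+1,\dots,n\},\{\sigma(i),k+1,\dots,n\}]\bigr).$$
   Context: Rows and columns of $M$ are indexed by $1,\dots,n$. For sets $U,W\subseteq\{1,\dots,n\}$ of the same size, $M[U,W]$ denotes the submatrix of $M$ consisting of only the rows indexed by $U$ and the columns indexed by $W$ (in their original increasing order). The determinant of the empty matrix $M[\emptyset,\emptyset]$ is $1$, and a zeroth power is $1$. $S_k$ is the group of permutations of $\{1,\dots,k\}$ and $\iota(\sigma)$ is the number of inversions of $\sigma$, so $(-1)^{\iota(\sigma)}=\mathrm{sgn}(\sigma)$. *)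

theory Defs
  imports
    "Jordan_Normal_Form.Determinant"
    "Jordan_Normal_Form.DL_Submatrix"
begin

(* The library indexes matrix rows and columns from 0, while U and W below are sets of
   indices counted from 1: row i of the mathematical matrix is row i - 1 of M. *)
definition submatrix_1 :: "'a mat \<Rightarrow> nat set \<Rightarrow> nat set \<Rightarrow> 'a mat" where
  "submatrix_1 M U W = submatrix M {i. Suc i \<in> U} {j. Suc j \<in> W}"

definition inversions :: "nat \<Rightarrow> (nat \<Rightarrow> nat) \<Rightarrow> nat" where
  "inversions k \<sigma> = card {(i, j). 1 \<le> i \<and> i < j \<and> j \<le> k \<and> \<sigma> i > \<sigma> j}"

end

theory Submission
  imports Defs "Jordan_Normal_Form.Char_Poly"
begin

text \<open>Write $M$ as a block matrix with blocks $A, B, C, D$, where $D$ is the trailing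
  $(n-k) \times (n-k)$ block, and put $d = \det D$, $N = d A - B\,\mathrm{adj}(D)\,C$. Multiplying
  $M$ by the block matrix with blocks $d I, 0, -\mathrm{adj}(D)\,C, I$ gives the block upper triangular
  matrix with blocks $N, B, 0, D$, hence $\det M \cdot d^k = \det N \cdot d$. If $d$ is not a zero
  divisor, then $\det M \cdot d^{k-1} = \det N$, and the case $k = 1$ of this identity identifies the
  entries of $N$ with the bordered minors. In general, replace $D$ by $X I + D$ over the polynomial
  ring, where the determinant is monic and hence regular, and evaluate at $X = 0$.\<close>

section \<open>Determinants of block triangular matrices\<close>

text \<open>For positive \<open>k\<close> the first row is a unit vector, so Laplace expansion along
  it leaves one cofactor: the same matrix with an identity block smaller by one.\<close>

lemma det_four_block_mat_one_zero:
  fixes D :: "'a :: comm_ring_1 mat"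
  assumes "D \<in> carrier_mat m m"
  shows "det (four_block_mat (1\<^sub>m k) (0\<^sub>m k m) (0\<^sub>m m k) D) = det D"
proof (induction k)
  case 0
  have "four_block_mat (1\<^sub>m 0) (0\<^sub>m 0 m) (0\<^sub>m m 0) D = D"
    using assms by (intro eq_matI) auto
  then show ?case by simp
next
  case (Suc k)
  let ?F = "\<lambda>k. four_block_mat (1\<^sub>m k) (0\<^sub>m k m) (0\<^sub>m m k) D"
  have F: "?F (Suc k) \<in> carrier_mat (Suc (k + m)) (Suc (k + m))"
    using assms by auto
  have "det (?F (Suc k)) = (\<Sum>j<Suc (k + m). ?F (Suc k) $$ (0, j) * cofactor (?F (Suc k)) 0 j)"
    by (rule laplace_expansion_row[OF F]) simp
  also have "\<dots> = (\<Sum>j<Suc (k + m). if j = 0 then cofactor (?F (Suc k)) 0 0 else 0)"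
    using assms by (intro sum.cong) auto
  also have "\<dots> = det (mat_delete (?F (Suc k)) 0 0)"
    by (simp add: cofactor_def)
  also have "mat_delete (?F (Suc k)) 0 0 = ?F k"
    using assms by (intro eq_matI) (auto simp: mat_delete_def)
  finally show ?case using Suc by simp
qed

text \<open>Here the last row is the unit vector, whatever \<open>B\<close> is. Deleting the last
  row and column also drops the last column of \<open>B\<close>, which is why the induction keeps
  \<open>B\<close> arbitrary.\<close>

lemma det_four_block_mat_zero_one:
  fixes A :: "'a :: comm_ring_1 mat"
  assumes "A \<in> carrier_mat k k" "B \<in> carrier_mat k m"
  shows "det (four_block_mat A B (0\<^sub>m m k) (1\<^sub>m m)) = det A"
  using assms(2)
proof (induction m arbitrary: B)
  case 0
  then have "four_block_mat A B (0\<^sub>m 0 k) (1\<^sub>m 0) = A"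
    using assms by (intro eq_matI) auto
  then show ?case by simp
next
  case (Suc m)
  let ?F = "four_block_mat A B (0\<^sub>m (Suc m) k) (1\<^sub>m (Suc m))"
  let ?B = "mat k m (\<lambda>(i, j). B $$ (i, j))"
  have F: "?F \<in> carrier_mat (Suc (k + m)) (Suc (k + m))"
    using assms Suc.prems by auto
  have "det ?F = (\<Sum>j<Suc (k + m). ?F $$ (k + m, j) * cofactor ?F (k + m) j)"
    by (rule laplace_expansion_row[OF F]) simp
  also have "\<dots> = (\<Sum>j<Suc (k + m). if j = k + m then cofactor ?F (k + m) (k + m) else 0)"
    using assms Suc.prems by (intro sum.cong) auto
  also have "\<dots> = det (mat_delete ?F (k + m) (k + m))"
    by (simp add: cofactor_def)
  also have "mat_delete ?F (k + m) (k + m) = four_block_mat A ?B (0\<^sub>m m k) (1\<^sub>m m)"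
    using assms Suc.prems by (intro eq_matI) (auto simp: mat_delete_def)
  finally show ?case using Suc.IH[of ?B] by simp
qed

text \<open>The matrix factors as diag(I, \<open>D\<close>) times the block matrix with blocks
  \<open>A\<close>, \<open>B\<close>, 0, I; the two preceding lemmas evaluate the factors.\<close>

lemma det_block_upper_triangular:
  fixes A :: "'a :: comm_ring_1 mat"
  assumes A: "A \<in> carrier_mat k k" and B: "B \<in> carrier_mat k m" and D: "D \<in> carrier_mat m m"
  shows "det (four_block_mat A B (0\<^sub>m m k) D) = det A * det D"
proof -
  let ?L = "four_block_mat (1\<^sub>m k) (0\<^sub>m k m) (0\<^sub>m m k) D"
  let ?U = "four_block_mat A B (0\<^sub>m m k) (1\<^sub>m m)"
  have "?L * ?U = four_block_mat A B (0\<^sub>m m k) D"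
    using assms by (subst mult_four_block_mat[where ?nr1.0 = k and ?n1.0 = k and ?n2.0 = m
      and ?nr2.0 = m and ?nc1.0 = k and ?nc2.0 = m]) auto
  moreover have "det (?L * ?U) = det ?L * det ?U"
    using assms by (intro det_mult[where n = "k + m"]) auto
  ultimately show ?thesis
    using det_four_block_mat_one_zero[OF D] det_four_block_mat_zero_one[OF A B]
    by (simp add: mult.commute)
qed

section \<open>Sylvester's identity when the determinant of the trailing block is regular\<close>

text \<open>A division-free Schur complement: the adjugate takes the place of det(\<open>D\<close>)
  times the inverse. The size \<open>k\<close> is left free because the identity serves twice, for
  the whole matrix and, with \<open>k\<close> = 1, for each bordered minor.\<close>

lemma det_four_block_mat_schur:
  fixes A :: "'a :: comm_ring_1 mat"
  assumes A: "A \<in> carrier_mat k k" and B: "B \<in> carrier_mat k m"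
    and C: "C \<in> carrier_mat m k" and D: "D \<in> carrier_mat m m" and k: "1 \<le> k"
    and regular: "\<And>x. x * det D = 0 \<Longrightarrow> x = 0"
  shows "det (four_block_mat A B C D) * det D ^ (k - 1) =
    det (det D \<cdot>\<^sub>m A - B * adj_mat D * C)"
proof -
  let ?X = "- (adj_mat D * C)"
  let ?U = "four_block_mat (det D \<cdot>\<^sub>m 1\<^sub>m k) (0\<^sub>m k m) ?X (1\<^sub>m m)"
  let ?M = "four_block_mat A B C D"
  let ?N = "det D \<cdot>\<^sub>m A - B * adj_mat D * C"
  note adj = adj_mat[OF D]
  have N: "?N \<in> carrier_mat k k" using A B C D adj by auto
  have "A * (det D \<cdot>\<^sub>m 1\<^sub>m k) + B * ?X = ?N"
  proof -
    have "B * ?X = - (B * adj_mat D * C)"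
      using B C adj(1) by (simp add: assoc_mult_mat[of _ k m _ m _ k])
    moreover have "A * (det D \<cdot>\<^sub>m 1\<^sub>m k) = det D \<cdot>\<^sub>m A"
      using A by (simp add: mult_smult_distrib[OF A one_carrier_mat])
    ultimately show ?thesis
      using A B C adj(1) by (simp add: minus_add_uminus_mat[of _ k k])
  qed
  moreover have "C * (det D \<cdot>\<^sub>m 1\<^sub>m k) + D * ?X = 0\<^sub>m m k"
  proof -
    have "D * ?X = - (D * adj_mat D * C)"
      using C D adj(1) by (simp add: assoc_mult_mat[of _ m m _ m _ k])
    also have "\<dots> = - (det D \<cdot>\<^sub>m C)"
      using C by (simp add: adj(2) mult_smult_assoc_mat[of _ m m _ k])
    finally have "D * ?X = - (det D \<cdot>\<^sub>m C)" .
    moreover have "C * (det D \<cdot>\<^sub>m 1\<^sub>m k) = det D \<cdot>\<^sub>m C"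
      using C by (simp add: mult_smult_distrib[OF C one_carrier_mat])
    ultimately show ?thesis
      using C by (auto intro!: eq_matI)
  qed
  ultimately have "?M * ?U = four_block_mat ?N B (0\<^sub>m m k) D"
    using A B C D adj(1) by (subst mult_four_block_mat[where ?nr1.0 = k and ?n1.0 = k and ?n2.0 = m
      and ?nr2.0 = m and ?nc1.0 = k and ?nc2.0 = m]) auto
  moreover have "det (?M * ?U) = det ?M * det ?U"
    using A B C D adj(1) by (intro det_mult[where n = "k + m"]) auto
  moreover have "det ?U = det D ^ k"
  proof -
    \<comment> \<open>\<open>?U\<close> is block lower triangular; transposing it makes the upper
      triangular evaluation applicable.\<close>
    have "transpose_mat ?U = four_block_mat (det D \<cdot>\<^sub>m 1\<^sub>m k) (transpose_mat ?X) (0\<^sub>m m k) (1\<^sub>m m)"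
      using C adj(1) by (subst transpose_four_block_mat[of _ k k _ m _ m]) (auto intro: eq_matI)
    moreover have "det (transpose_mat ?U) = det ?U"
      using C adj(1) by (intro det_transpose[where n = "k + m"]) auto
    ultimately show ?thesis
      using C adj(1) det_four_block_mat_zero_one[of "det D \<cdot>\<^sub>m 1\<^sub>m k" k "transpose_mat ?X" m]
      by auto
  qed
  ultimately have "det ?M * det D ^ k = det ?N * det D"
    using det_block_upper_triangular[OF N B D] by simp
  \<comment> \<open>Since \<open>k\<close> is positive, the truncated \<open>k - 1\<close> is the
    true predecessor. Both sides then share a factor \<open>det D\<close>, and
    \<open>regular\<close>, applied to their difference, cancels it.\<close>
  moreover have "det D ^ k = det D ^ (k - 1) * det D"
    using k by (simp flip: power_Suc2)
  ultimately have "(det ?M * det D ^ (k - 1) - det ?N) * det D = 0"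
    by (simp add: algebra_simps)
  then show ?thesis using regular by fastforce
qed

text \<open>\<open>D\<close> bordered by row \<open>i\<close> of \<open>B\<close> and column
  \<open>j\<close> of \<open>C\<close>, with 0-based indices. The border stands first, so that this
  is the Schur situation with a 1 x 1 leading block.\<close>

definition bordered_det ::
    "'a :: comm_ring_1 mat \<Rightarrow> 'a mat \<Rightarrow> 'a mat \<Rightarrow> 'a mat \<Rightarrow> nat \<Rightarrow> nat \<Rightarrow> 'a" where
  "bordered_det A B C D i j =
    det (four_block_mat (mat 1 1 (\<lambda>_. A $$ (i, j))) (mat 1 (dim_col B) (\<lambda>(_, c). B $$ (i, c)))
      (mat (dim_row C) 1 (\<lambda>(r, _). C $$ (r, j))) D)"

lemma sylvester_regular:
  fixes A :: "'a :: comm_ring_1 mat"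
  assumes A: "A \<in> carrier_mat k k" and B: "B \<in> carrier_mat k m"
    and C: "C \<in> carrier_mat m k" and D: "D \<in> carrier_mat m m" and k: "1 \<le> k"
    and regular: "\<And>x. x * det D = 0 \<Longrightarrow> x = 0"
  shows "det (four_block_mat A B C D) * det D ^ (k - 1) =
    det (mat k k (\<lambda>(i, j). bordered_det A B C D i j))"
proof -
  let ?N = "det D \<cdot>\<^sub>m A - B * adj_mat D * C"
  note adj = adj_mat[OF D]
  have "bordered_det A B C D i j = ?N $$ (i, j)" if ij: "i < k" "j < k" for i j
  proof -
    let ?a = "mat 1 1 (\<lambda>_. A $$ (i, j))" and ?b = "mat 1 m (\<lambda>(_, c). B $$ (i, c))"
    let ?c = "mat m 1 (\<lambda>(r, _). C $$ (r, j))"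
    \<comment> \<open>The factor \<open>det D ^ (1 - 1)\<close> is 1; it is inserted to match the
      Schur identity at size 1.\<close>
    have "bordered_det A B C D i j = det (four_block_mat ?a ?b ?c D) * det D ^ (1 - 1)"
      using B C by (simp add: bordered_det_def)
    also have "\<dots> = det (det D \<cdot>\<^sub>m ?a - ?b * adj_mat D * ?c)"
      by (rule det_four_block_mat_schur[OF _ _ _ D _ regular]) auto
    also have "\<dots> = (det D \<cdot>\<^sub>m ?a - ?b * adj_mat D * ?c) $$ (0, 0)"
      using adj(1) by (intro det_single) auto
    also have "\<dots> = ?N $$ (i, j)"
    proof -
      \<comment> \<open>Entry (\<open>i\<close>, \<open>j\<close>) of
        \<open>B * adj_mat D * C\<close> depends only on row \<open>i\<close> of \<open>B\<close>
        and column \<open>j\<close> of \<open>C\<close>. The product stays left associated so that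
        the fact about rows of \<open>B * adj_mat D\<close> applies.\<close>
      have "row ?b 0 = row B i" "col ?c 0 = col C j"
        using B C ij by (auto intro!: eq_vecI)
      moreover have "row (?b * adj_mat D) 0 = row (B * adj_mat D) i"
        using adj(1) B ij calculation by (auto intro!: eq_vecI)
      ultimately show ?thesis using A B C adj(1) ij by (simp del: assoc_mult_mat)
    qed
    finally show ?thesis .
  qed
  then have "mat k k (\<lambda>(i, j). bordered_det A B C D i j) = ?N"
    using A B C adj(1) by (intro eq_matI) auto
  then show ?thesis using det_four_block_mat_schur[OF A B C D k regular] by simp
qed

section \<open>Removing the regularity hypothesis\<close>

text \<open>The identity is first obtained over the polynomial ring for a perturbed
  \<open>D\<close>. Evaluation at 0 is a ring homomorphism, hence commutes with determinants, and
  carries it back to the original blocks.\<close>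

lemma sylvester_four_block_mat:
  fixes A :: "'a :: comm_ring_1 mat"
  assumes A: "A \<in> carrier_mat k k" and B: "B \<in> carrier_mat k m"
    and C: "C \<in> carrier_mat m k" and D: "D \<in> carrier_mat m m" and k: "1 \<le> k"
  shows "det (four_block_mat A B C D) * det D ^ (k - 1) =
    det (mat k k (\<lambda>(i, j). bordered_det A B C D i j))"
proof -
  have "comm_ring_hom (\<lambda>p :: 'a poly. poly p 0)" by unfold_locales
  note hom_det = comm_ring_hom.hom_det[OF this]
  let ?l = "map_mat (\<lambda>a. [:a:])" and ?ev = "map_mat (\<lambda>p :: 'a poly. poly p 0)"
  \<comment> \<open>The characteristic matrix of \<open>- D\<close> is X I + \<open>D\<close>: its
    determinant is monic and its value at X = 0 is \<open>D\<close>.\<close>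
  let ?D = "char_poly_matrix (- D)"
  have D': "?D \<in> carrier_mat m m" using D by auto
  have evD: "?ev ?D = D"
    using D by (intro eq_matI) (auto simp: char_poly_matrix_def)
  have ev_id: "?ev (?l X) = X" for X by (intro eq_matI) auto
  have regular: "x = 0" if "x * det ?D = 0" for x
  proof -
    \<comment> \<open>Multiplying by a monic polynomial preserves the leading coefficient, even if
      the base ring has zero divisors; so a zero product forces \<open>x\<close> to have leading
      coefficient 0.\<close>
    have "degree (det ?D) = m \<and> coeff (det ?D) m = 1"
      using degree_monic_char_poly[of "- D" m] D by (simp add: char_poly_def)
    then have "coeff (x * det ?D) (degree x + degree (det ?D)) = lead_coeff x"
      using coeff_mult_degree_sum[of x "det ?D"] by simp
    then show ?thesis using that by simp
  qed
  have "bordered_det A B C D i j = poly (bordered_det (?l A) (?l B) (?l C) ?D i j) 0"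
    if "i < k" "j < k" for i j
  proof -
    let ?a = "mat 1 1 (\<lambda>_. ?l A $$ (i, j))"
    let ?b = "mat 1 m (\<lambda>(_, c). ?l B $$ (i, c))"
    let ?c = "mat m 1 (\<lambda>(r, _). ?l C $$ (r, j))"
    have "?ev (four_block_mat ?a ?b ?c ?D) = four_block_mat (?ev ?a) (?ev ?b) (?ev ?c) (?ev ?D)"
      using D' by (intro map_four_block_mat[of _ 1 1 _ m _ m]) auto
    moreover have "?ev ?a = mat 1 1 (\<lambda>_. A $$ (i, j))" "?ev ?b = mat 1 m (\<lambda>(_, c). B $$ (i, c))"
      "?ev ?c = mat m 1 (\<lambda>(r, _). C $$ (r, j))"
      using A B C that by (auto intro!: eq_matI)
    ultimately show ?thesis
      using B C by (simp add: bordered_det_def evD flip: hom_det)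
  qed
  then have "mat k k (\<lambda>(i, j). bordered_det A B C D i j) =
      ?ev (mat k k (\<lambda>(i, j). bordered_det (?l A) (?l B) (?l C) ?D i j))"
    by (intro eq_matI) auto
  moreover have "four_block_mat A B C D = ?ev (four_block_mat (?l A) (?l B) (?l C) ?D)"
    using A B C D' evD ev_id by (subst map_four_block_mat[of _ k k _ m _ m]) auto
  moreover have "det D = poly (det ?D) 0" using evD by (simp flip: hom_det)
  moreover have "det (four_block_mat (?l A) (?l B) (?l C) ?D) * det ?D ^ (k - 1) =
      det (mat k k (\<lambda>(i, j). bordered_det (?l A) (?l B) (?l C) ?D i j))"
    using A B C by (intro sylvester_regular[OF _ _ _ D' k regular]) auto
  ultimately show ?thesis
    by (metis (no_types, lifting) hom_det poly_mult poly_power)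
qed

section \<open>Inversions and the sign of a permutation\<close>

lemma finite_increasing_pairs: "finite {(i :: nat, j). 1 \<le> i \<and> i < j \<and> j \<le> k}"
  by (rule finite_subset[of _ "{..k} \<times> {..k}"]) auto

text \<open>Turning the count into a product with one sign per increasing pair makes reindexing
  possible when permutations are composed.\<close>

lemma minus_one_power_inversions:
  "(-1 :: int) ^ inversions k p =
    (\<Prod>(i, j)\<in>{(i, j). 1 \<le> i \<and> i < j \<and> j \<le> k}. if p i > p j then -1 else 1)"
  (is "_ = prod ?s ?P")
proof -
  let ?I = "{(i, j). 1 \<le> i \<and> i < j \<and> j \<le> k \<and> p i > p j}"
  have "prod ?s ?P = prod ?s ?I"
    by (rule prod.mono_neutral_right[OF finite_increasing_pairs]) (auto split: if_splits)
  also have "\<dots> = (\<Prod>x\<in>?I. -1)" by (rule prod.cong) auto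
  finally show ?thesis by (simp add: inversions_def)
qed

text \<open>The sign of \<open>p \<circ> q\<close> at (i, j) is the sign of \<open>q\<close> there
  times the sign of \<open>p\<close> at the sorted pair of \<open>q i\<close> and
  \<open>q j\<close>: sorting swaps the two entries exactly when \<open>q\<close> inverts the pair.
  The map \<open>?h\<close> to sorted image pairs permutes the increasing pairs, so the second
  factors multiply to the sign product of \<open>p\<close>.\<close>

lemma minus_one_power_inversions_comp:
  assumes p: "p permutes {1..k}" and q: "q permutes {1..k}"
  shows "(-1 :: int) ^ inversions k (p \<circ> q) = (-1) ^ inversions k p * (-1) ^ inversions k q"
proof -
  let ?P = "{(i :: nat, j). 1 \<le> i \<and> i < j \<and> j \<le> k}"
  let ?s = "\<lambda>p (i :: nat, j :: nat). if p i > p j then -1 else 1 :: int"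
  let ?h = "\<lambda>(i, j). (min (q i) (q j), max (q i) (q j))"
  have q_in: "1 \<le> q i \<and> q i \<le> k" if "1 \<le> i" "i \<le> k" for i
    using permutes_in_image[OF q, of i] that by simp
  have q_eq: "q i = q j \<longleftrightarrow> i = j" for i j
    using permutes_inj[OF q] by (auto dest: injD)
  have p_eq: "p i = p j \<longleftrightarrow> i = j" for i j
    using permutes_inj[OF p] by (auto dest: injD)
  have "inj_on ?h ?P"
    by (auto simp: inj_on_def min_def max_def q_eq split: if_splits)
  moreover have "?h ` ?P \<subseteq> ?P"
    using q_in q_eq by (force simp: min_def max_def order.strict_iff_order)
  ultimately have h: "bij_betw ?h ?P ?P"
    using endo_inj_surj[OF finite_increasing_pairs] by (auto simp: bij_betw_def)
  have "(-1 :: int) ^ inversions k (p \<circ> q) = prod (?s (p \<circ> q)) ?P"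
    by (simp add: minus_one_power_inversions)
  also have "\<dots> = (\<Prod>x\<in>?P. ?s p (?h x) * ?s q x)"
  proof (rule prod.cong[OF refl])
    fix x
    assume "x \<in> ?P"
    then obtain i j where x: "x = (i, j)" and "i < j" by auto
    then have "q i \<noteq> q j" "p (q i) \<noteq> p (q j)" by (auto simp: q_eq p_eq)
    then show "?s (p \<circ> q) x = ?s p (?h x) * ?s q x"
      by (auto simp: x min_def max_def)
  qed
  also have "\<dots> = prod (?s p) ?P * prod (?s q) ?P"
    using prod.reindex_bij_betw[OF h, of "?s p"] by (simp add: prod.distrib)
  finally show ?thesis by (simp add: minus_one_power_inversions)
qed

text \<open>The inverted pairs are (a, j) with a < j \<le> b and (i, b) with a < i < b. The pair (a,
  b) is counted once and the others match up, so the number is odd.\<close>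

lemma inversions_transpose:
  assumes "1 \<le> a" "a < b" "b \<le> k"
  shows "inversions k (transpose a b) = Suc (2 * (b - a - 1))"
proof -
  have "{(i, j). 1 \<le> i \<and> i < j \<and> j \<le> k \<and> transpose a b i > transpose a b j} =
      {a} \<times> {a<..b} \<union> {a<..<b} \<times> {b}"
    using assms by (auto simp: transpose_def split: if_splits)
  moreover have "card ({a} \<times> {a<..b} \<union> {a<..<b} \<times> {b}) = (b - a) + (b - a - 1)"
    by (subst card_Un_disjoint) (auto simp: card_cartesian_product)
  ultimately show ?thesis using assms by (simp add: inversions_def)
qed

text \<open>Both sides are multiplicative and equal -1 on transpositions, which generate the
  permutations of a finite set.\<close>

lemma minus_one_power_inversions_eq_sign:
  assumes "p permutes {1..k}"
  shows "(-1 :: int) ^ inversions k p = sign p"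
  using assms finite_atLeastAtMost
proof (induction rule: permutes_induct)
  case id
  have "{(i :: nat, j). 1 \<le> i \<and> i < j \<and> j \<le> k \<and> id i > id j} = {}" by auto
  then show ?case by (simp only: inversions_def) simp
next
  case (swap a b p)
  have t: "transpose a b permutes {1..k}" using swap.hyps by (simp add: permutes_swap_id)
  have "(-1 :: int) ^ inversions k (transpose a b) = -1"
  \<comment> \<open>The induction supplies distinct \<open>a\<close> and \<open>b\<close> in either
    order, while the inversion count wants the smaller one first.\<close>
  proof (cases "a < b")
    case True
    then show ?thesis using inversions_transpose[of a b k] swap.hyps by simp
  next
    case False
    then show ?thesis using inversions_transpose[of b a k] swap.hyps
      by (simp add: transpose_commute)
  qed
  moreover have "sign (transpose a b \<circ> p) = sign (transpose a b) * sign p"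
    by (rule sign_compose) (use t swap.hyps in \<open>auto intro: permutes_imp_permutation\<close>)
  ultimately show ?case
    using swap minus_one_power_inversions_comp[OF t, of p] by (simp add: sign_swap_id o_def)
qed

text \<open>The Leibniz formula moved from permutations of {0..<k} to those of {1..k}. Conjugation
  by \<open>Suc\<close> is a bijection between them that preserves signs.\<close>

lemma det_mat_inversions:
  fixes f :: "nat \<Rightarrow> nat \<Rightarrow> 'a :: comm_ring_1"
  shows "det (mat k k (\<lambda>(i, j). f (Suc i) (Suc j))) =
    (\<Sum>\<sigma> | \<sigma> permutes {1..k}. (-1) ^ inversions k \<sigma> * (\<Prod>i=1..k. f i (\<sigma> i)))"
proof -
  let ?g = "map_permutation {0..<k} Suc"
  have Suc_bij: "bij_betw Suc {0..<k} {1..k}"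
    by (auto simp: bij_betw_def image_Suc_atLeastLessThan atLeastLessThanSuc_atLeastAtMost)
  \<comment> \<open>This is the explicit form of conjugation in which
    \<open>bij_betw_permutations\<close> states its bijection.\<close>
  have "?g = (\<lambda>p x. if x \<in> {1..k} then Suc (p (inv_into {0..<k} Suc x)) else x)"
    using Suc_bij by (intro ext) (simp add: map_permutation_def restrict_id_def bij_betw_def)
  then have bij: "bij_betw ?g {p. p permutes {0..<k}} {\<sigma>. \<sigma> permutes {1..k}}"
    using bij_betw_permutations[OF Suc_bij] by simp
  have summand: "(-1) ^ inversions k (?g p) * (\<Prod>i=1..k. f i (?g p i)) =
      signof p * (\<Prod>i=0..<k. f (Suc i) (Suc (p i)))" if p: "p permutes {0..<k}" for p
  proof -
    have "sign (?g p) = sign p" using p by (intro sign_map_permutation) auto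
    moreover have "?g p permutes {1..k}" using bij p by (auto simp: bij_betw_def)
    \<comment> \<open>The sign identity lives in the integers; \<open>of_int\<close> transports it
      to the ring.\<close>
    ultimately have "(-1 :: 'a) ^ inversions k (?g p) = signof p"
      using arg_cong[OF minus_one_power_inversions_eq_sign, of _ _ "of_int :: int \<Rightarrow> 'a"] by simp
    moreover have "(\<Prod>i=1..k. f i (?g p i)) = (\<Prod>i=0..<k. f (Suc i) (?g p (Suc i)))"
      using prod.reindex_bij_betw[OF Suc_bij, of "\<lambda>i. f i (?g p i)"] by simp
    moreover have "?g p (Suc i) = Suc (p i)" if "i < k" for i
      using that by (intro map_permutation_apply) auto
    ultimately show ?thesis by simp
  qed
  have "det (mat k k (\<lambda>(i, j). f (Suc i) (Suc j))) =
      (\<Sum>p | p permutes {0..<k}. signof p * (\<Prod>i=0..<k. f (Suc i) (Suc (p i))))"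
    by (subst det_def'[of _ k]) (auto intro!: sum.cong prod.cong arg_cong2[of _ _ _ _ "(*)"])
  also have "\<dots> = (\<Sum>p | p permutes {0..<k}.
      (-1) ^ inversions k (?g p) * (\<Prod>i=1..k. f i (?g p i)))"
    by (rule sum.cong[OF refl], rule summand[symmetric]) simp
  also have "\<dots> = (\<Sum>\<sigma> | \<sigma> permutes {1..k}. (-1) ^ inversions k \<sigma> * (\<Prod>i=1..k. f i (\<sigma> i)))"
    by (rule sum.reindex_bij_betw[OF bij])
  finally show ?thesis .
qed

section \<open>Submatrices as explicit block matrices\<close>

lemma card_bordered_index_set:
  assumes "1 \<le> i" "i \<le> k" "k \<le> n"
  shows "card {r. r < n \<and> Suc r \<in> {i} \<union> {k+1..n}} = Suc (n - k)"
proof -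
  have "{r. r < n \<and> Suc r \<in> {i} \<union> {k+1..n}} = insert (i - 1) {k..<n}"
    using assms by auto
  then show ?thesis using assms by simp
qed

text \<open>\<open>pick\<close> enumerates in increasing order, so its value at \<open>r\<close> is
  the member with exactly \<open>r\<close> smaller members. As i \<le> k, the border index i - 1
  precedes the tail and takes position 0, which shifts the tail by one.\<close>

lemma pick_bordered_index_set:
  assumes "1 \<le> i" "i \<le> k" "k \<le> n" "r \<le> n - k"
  shows "pick {r. Suc r \<in> {i} \<union> {k+1..n}} r = (if r = 0 then i - 1 else k + (r - 1))"
proof -
  let ?I = "{r. Suc r \<in> {i} \<union> {k+1..n}}"
  let ?x = "if r = 0 then i - 1 else k + (r - 1)"
  have "{a\<in>?I. a < ?x} = (if r = 0 then {} else insert (i - 1) {k..<k + (r - 1)})"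
    using assms by auto
  then have "card {a\<in>?I. a < ?x} = r" using assms by auto
  moreover have "?x \<in> ?I" using assms by auto
  ultimately show ?thesis using pick_card_in_set[of ?x ?I] by (simp only:)
qed

lemma pick_tail_index_set:
  assumes "r < n - k"
  shows "pick {r. Suc r \<in> {k+1..n}} r = k + r"
proof -
  let ?I = "{r. Suc r \<in> {k+1..n}}"
  have "{a\<in>?I. a < k + r} = {k..<k + r}" using assms by auto
  then have "card {a\<in>?I. a < k + r} = r" by simp
  moreover have "k + r \<in> ?I" using assms by auto
  ultimately show ?thesis using pick_card_in_set by metis
qed

lemma submatrix_1_tail:
  assumes "M \<in> carrier_mat n n"
  shows "submatrix_1 M {k+1..n} {k+1..n} = mat (n - k) (n - k) (\<lambda>(r, c). M $$ (k + r, k + c))"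
proof -
  have "{r. r < n \<and> Suc r \<in> {k+1..n}} = {k..<n}" by auto
  then have "card {r. r < n \<and> Suc r \<in> {k+1..n}} = n - k" by simp
  then show ?thesis
    using assms pick_tail_index_set[of _ n k]
    by (intro eq_matI) (auto simp: submatrix_1_def submatrix_def)
qed

text \<open>Keeping the original order puts the border row and column first, since i, j \<le> k; no
  rearrangement sign appears, and the block shape is that of \<open>bordered_det\<close>.\<close>

lemma submatrix_1_bordered:
  assumes "M \<in> carrier_mat n n" "1 \<le> i" "i \<le> k" "1 \<le> j" "j \<le> k" "k \<le> n"
  shows "submatrix_1 M ({i} \<union> {k+1..n}) ({j} \<union> {k+1..n}) =
    four_block_mat (mat 1 1 (\<lambda>_. M $$ (i - 1, j - 1)))
      (mat 1 (n - k) (\<lambda>(_, c). M $$ (i - 1, k + c)))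
      (mat (n - k) 1 (\<lambda>(r, _). M $$ (k + r, j - 1)))
      (mat (n - k) (n - k) (\<lambda>(r, c). M $$ (k + r, k + c)))"
  (is "?L = ?R")
proof (rule eq_matI)
  note card = card_bordered_index_set[OF assms(2,3,6)] card_bordered_index_set[OF assms(4-6)]
  show "dim_row ?L = dim_row ?R" "dim_col ?L = dim_col ?R"
    using assms(1) card by (simp_all add: submatrix_1_def dim_submatrix)
  fix r c
  assume "r < dim_row ?R" "c < dim_col ?R"
  then have rc: "r \<le> n - k" "c \<le> n - k" by auto
  then have "?L $$ (r, c) = M $$ (pick {r. Suc r \<in> {i} \<union> {k+1..n}} r, pick {c. Suc c \<in> {j} \<union> {k+1..n}} c)"
    using assms(1) card unfolding submatrix_1_def
    by (intro submatrix_index) simp_all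
  also have "\<dots> = ?R $$ (r, c)"
    using rc pick_bordered_index_set[OF assms(2,3,6)] pick_bordered_index_set[OF assms(4-6)] by auto
  finally show "?L $$ (r, c) = ?R $$ (r, c)" .
qed

theorem theorem1p0p2:
  fixes M :: "'a :: comm_ring_1 mat" and n k :: nat
  assumes "M \<in> carrier_mat n n"
    and "1 \<le> k" and "k \<le> n"
  shows "det M * det (submatrix_1 M {k+1..n} {k+1..n}) ^ (k - 1) =
    (\<Sum>\<sigma> | \<sigma> permutes {1..k}. (-1) ^ inversions k \<sigma> *
      (\<Prod>i=1..k. det (submatrix_1 M ({i} \<union> {k+1..n}) ({\<sigma> i} \<union> {k+1..n}))))"
proof -
  let ?m = "n - k"
  let ?A = "mat k k (\<lambda>(i, j). M $$ (i, j))" and ?B = "mat k ?m (\<lambda>(i, c). M $$ (i, k + c))"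
  let ?C = "mat ?m k (\<lambda>(r, j). M $$ (k + r, j))"
  let ?D = "mat ?m ?m (\<lambda>(r, c). M $$ (k + r, k + c))"
  let ?f = "\<lambda>i j. det (submatrix_1 M ({i} \<union> {k+1..n}) ({j} \<union> {k+1..n}))"
  have M: "M = four_block_mat ?A ?B ?C ?D"
    using assms by (intro eq_matI) auto
  \<comment> \<open>The 0-based border position (\<open>i\<close>, \<open>j\<close>) corresponds to
    the 1-based indices \<open>Suc i\<close> and \<open>Suc j\<close> of the minors in the
    sum.\<close>
  have bordered: "bordered_det ?A ?B ?C ?D i j = ?f (Suc i) (Suc j)" if "i < k" "j < k" for i j
  proof -
    have "mat 1 (dim_col ?B) (\<lambda>(_, c). ?B $$ (i, c)) = mat 1 ?m (\<lambda>(_, c). M $$ (i, k + c))"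
      "mat (dim_row ?C) 1 (\<lambda>(r, _). ?C $$ (r, j)) = mat ?m 1 (\<lambda>(r, _). M $$ (k + r, j))"
      using that by (auto intro!: cong_mat)
    then show ?thesis
      using that assms by (subst submatrix_1_bordered) (simp_all add: bordered_det_def)
  qed
  have "det M * det (submatrix_1 M {k+1..n} {k+1..n}) ^ (k - 1) =
      det (four_block_mat ?A ?B ?C ?D) * det ?D ^ (k - 1)"
    using M submatrix_1_tail[OF assms(1)] by simp
  also have "\<dots> = det (mat k k (\<lambda>(i, j). bordered_det ?A ?B ?C ?D i j))"
    by (rule sylvester_four_block_mat[OF _ _ _ _ assms(2)]) auto
  also have "mat k k (\<lambda>(i, j). bordered_det ?A ?B ?C ?D i j) = mat k k (\<lambda>(i, j). ?f (Suc i) (Suc j))"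
    by (rule cong_mat) (simp_all only: prod.case bordered)
  also have "det \<dots> =
      (\<Sum>\<sigma> | \<sigma> permutes {1..k}. (-1) ^ inversions k \<sigma> * (\<Prod>i=1..k. ?f i (\<sigma> i)))"
    by (rule det_mat_inversions)
  finally show ?thesis .
qed

end
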